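(* Let $G=(V,E)$ be a finite digraph with $n=|V|$ vertices, in which every vertex has at least one outgoing arc, with $V=B\cup W$ partitioned into positions of \textsc{Min} ($B$) and of \textsc{Max} ($W$), and let $r:E\to\mathbb{R}$ be a local reward function with $R=\max_{e\in E}|r(e)|$. Let $k\in\mathbb{Z}_+$ and choose a discount factor $\beta\in(0,1)$ satisfying $0\le 1-\beta<\frac{\epsilon(k,r)}{4n^{k+3}R}$. Let $(\sigma_B^*,\sigma_W^* )$ be a uniform saddle point (within pure stationary strategies) of the game with effective reward $\pi=\phi_\beta$. Then $(\sigma_B^*,\sigma_W^* )$ is also a uniform saddle point (within pure stationary strategies) of the game with effective reward $\pi=\phi^{(k)}$.
   Context: For an infinite real sequence $\mathbf a=(a_1,a_2,\dots)$ define $A(\mathbf a)=\liminf_{T\to\infty}\frac1T\sum_{j=1}^T a_j$, $A_\beta(\mathbf a)=(1-\beta)\sum_{j\ge1}\beta^{j-1}a_j$, and $M(\mathbf a)=\mathbf b$ with $b_i=\sum_{j=1}^i a_j$; $M^0$ is the identity and $M^k=M\circ M^{k-1}$. The $k$-total reward is $\phi^{(k)}(\mathbf a)=A(M^k(\mathbf a))\in\mathbb{R}\cup\{\pm\infty\}$ and the discounted mean payoff is $\phi_\beta(\mathbf a)=A_\beta(\mathbf a)$. A pure stationary strategy of \textsc{Min} (resp. \textsc{Max}) is a set $F\subseteq E$ of arcs containing exactly one outgoing arc of every $v\in B$ (resp. $v\in W$) and all arcs leaving the other player's vertices. A pair $(\sigma_B,\sigma_W)$ of pure stationary strategies and an initial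 position $v_0$ determine a unique walk consisting of an initial path $e_1,\dots,e_p$ followed by a cycle $e_{p+1},\dots,e_{p+q}$ repeated forever; with $\mathbf x=(r(e_1),\dots,r(e_p))$, $\mathbf y=(r(e_{p+1}),\dots,r(e_{p+q}))$, the play's reward sequence is the lasso sequence $\mathbf x(\mathbf y)$ ($\mathbf x$ followed by $\mathbf y$ repeated infinitely often), and the payoff is $c(v_0;\sigma_B,\sigma_W)=\pi(\mathbf x(\mathbf y))$. A pair $(\sigma_B^*,\sigma_W^* )$ is a uniform saddle point if $c(v_0;\sigma_B^*,\sigma_W)\le c(v_0;\sigma_B^*,\sigma_W^* )\le c(v_0;\sigma_B,\sigma_W^* )$ for all pure stationary $\sigma_B,\sigma_W$ and all initial positions $v_0\in V$. For a positive integer $\ell$, $\epsilon(\ell,r)>0$ denotes the smallest positive number that arises as the absolute value of an integer linear combination of the values $r(e)$, $e\in E$, with coefficients not larger than $n^{\ell+1}$ (in absolute value). *)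

theory Defs
  imports "HOL-Analysis.Analysis" "Graph_Theory.Digraph"
begin

text \<open>Sequences \<open>a\<^sub>1, a\<^sub>2, \<dots>\<close> are indexed from \<open>0\<close>: \<open>a j\<close> stands for the entry with index \<open>j + 1\<close>.\<close>

definition limit_mean :: "(nat \<Rightarrow> real) \<Rightarrow> ereal" where
  "limit_mean a = liminf (\<lambda>T. ereal ((\<Sum>j<T. a j) / real T))"

definition discounted_mean :: "real \<Rightarrow> (nat \<Rightarrow> real) \<Rightarrow> real" where
  "discounted_mean \<beta> a = (1 - \<beta>) * (\<Sum>j. \<beta> ^ j * a j)"

definition partial_sums :: "(nat \<Rightarrow> real) \<Rightarrow> (nat \<Rightarrow> real)" where
  "partial_sums a = (\<lambda>i. \<Sum>j\<le>i. a j)"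

definition total_reward :: "nat \<Rightarrow> (nat \<Rightarrow> real) \<Rightarrow> ereal" where
  "total_reward k a = limit_mean ((partial_sums ^^ k) a)"

definition discounted_reward :: "real \<Rightarrow> (nat \<Rightarrow> real) \<Rightarrow> ereal" where
  "discounted_reward \<beta> a = ereal (discounted_mean \<beta> a)"

definition lasso :: "'a list \<Rightarrow> 'a list \<Rightarrow> nat \<Rightarrow> 'a" where
  "lasso xs ys i =
     (if i < length xs then xs ! i else ys ! ((i - length xs) mod length ys))"

text \<open>A pure stationary strategy of the player who controls the positions in \<open>P\<close>.\<close>

definition pure_stationary_strategy ::
    "('v, 'e) pre_digraph \<Rightarrow> 'v set \<Rightarrow> 'e set \<Rightarrow> bool" where
  "pure_stationary_strategy G P F \<longleftrightarrow>
     F \<subseteq> arcs G \<and>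
     (\<forall>v\<in>P. \<exists>!e. e \<in> F \<inter> out_arcs G v) \<and>
     (\<forall>v\<in>verts G - P. out_arcs G v \<subseteq> F)"

text \<open>
  Below, \<open>F\<close> is the intersection of the strategies of the two players, which contains exactly
  one outgoing arc of every vertex.
\<close>

definition chosen_arc :: "('v, 'e) pre_digraph \<Rightarrow> 'e set \<Rightarrow> 'v \<Rightarrow> 'e" where
  "chosen_arc G F v = (THE e. e \<in> F \<inter> out_arcs G v)"

definition walk_position :: "('v, 'e) pre_digraph \<Rightarrow> 'e set \<Rightarrow> 'v \<Rightarrow> nat \<Rightarrow> 'v" where
  "walk_position G F v0 i = ((\<lambda>v. head G (chosen_arc G F v)) ^^ i) v0"

definition walk_arc :: "('v, 'e) pre_digraph \<Rightarrow> 'e set \<Rightarrow> 'v \<Rightarrow> nat \<Rightarrow> 'e" where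
  "walk_arc G F v0 i = chosen_arc G F (walk_position G F v0 i)"

definition path_length :: "('v, 'e) pre_digraph \<Rightarrow> 'e set \<Rightarrow> 'v \<Rightarrow> nat" where
  "path_length G F v0 =
     (LEAST p. \<exists>q>0. walk_position G F v0 (p + q) = walk_position G F v0 p)"

definition cycle_length :: "('v, 'e) pre_digraph \<Rightarrow> 'e set \<Rightarrow> 'v \<Rightarrow> nat" where
  "cycle_length G F v0 =
     (LEAST q. q > 0 \<and> walk_position G F v0 (path_length G F v0 + q) =
                       walk_position G F v0 (path_length G F v0))"

definition reward_sequence ::
    "('v, 'e) pre_digraph \<Rightarrow> ('e \<Rightarrow> real) \<Rightarrow> 'e set \<Rightarrow> 'v \<Rightarrow> nat \<Rightarrow> real" where
  "reward_sequence G r F v0 =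
     (let p = path_length G F v0;
          q = cycle_length G F v0
      in lasso (map (\<lambda>i. r (walk_arc G F v0 i)) [0..<p])
               (map (\<lambda>i. r (walk_arc G F v0 i)) [p..<p + q]))"

definition payoff ::
    "((nat \<Rightarrow> real) \<Rightarrow> ereal) \<Rightarrow> ('v, 'e) pre_digraph \<Rightarrow> ('e \<Rightarrow> real) \<Rightarrow>
     'v \<Rightarrow> 'e set \<Rightarrow> 'e set \<Rightarrow> ereal" where
  "payoff \<pi> G r v0 \<sigma>B \<sigma>W = \<pi> (reward_sequence G r (\<sigma>B \<inter> \<sigma>W) v0)"

definition uniform_saddle_point ::
    "((nat \<Rightarrow> real) \<Rightarrow> ereal) \<Rightarrow> ('v, 'e) pre_digraph \<Rightarrow> 'v set \<Rightarrow> 'v set \<Rightarrow>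
     ('e \<Rightarrow> real) \<Rightarrow> 'e set \<Rightarrow> 'e set \<Rightarrow> bool" where
  "uniform_saddle_point \<pi> G B W r \<sigma>B' \<sigma>W' \<longleftrightarrow>
     pure_stationary_strategy G B \<sigma>B' \<and>
     pure_stationary_strategy G W \<sigma>W' \<and>
     (\<forall>\<sigma>B \<sigma>W v0.
        pure_stationary_strategy G B \<sigma>B \<longrightarrow>
        pure_stationary_strategy G W \<sigma>W \<longrightarrow>
        v0 \<in> verts G \<longrightarrow>
        payoff \<pi> G r v0 \<sigma>B' \<sigma>W \<le> payoff \<pi> G r v0 \<sigma>B' \<sigma>W' \<and>
        payoff \<pi> G r v0 \<sigma>B' \<sigma>W' \<le> payoff \<pi> G r v0 \<sigma>B \<sigma>W')"

definition max_abs_reward :: "('v, 'e) pre_digraph \<Rightarrow> ('e \<Rightarrow> real) \<Rightarrow> real" where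
  "max_abs_reward G r = Max ((\<lambda>e. \<bar>r e\<bar>) ` arcs G)"

text \<open>
  The minimum exists whenever \<open>r\<close> is not identically zero on the arcs of a finite digraph;
  otherwise the value is unspecified.
\<close>

definition reward_gap :: "('v, 'e) pre_digraph \<Rightarrow> nat \<Rightarrow> ('e \<Rightarrow> real) \<Rightarrow> real" where
  "reward_gap G l r =
     (LEAST x. x > 0 \<and>
        (\<exists>c :: 'e \<Rightarrow> int.
           (\<forall>e\<in>arcs G. \<bar>c e\<bar> \<le> int (card (verts G) ^ (l + 1))) \<and>
           x = \<bar>\<Sum>e\<in>arcs G. of_int (c e) * r e\<bar>))"


subsection \<open>The lasso sequence is the reward sequence of the infinite walk\<close>

lemma chosen_arc_props:
  assumes "pure_stationary_strategy G B \<sigma>B" "pure_stationary_strategy G W \<sigma>W"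
    and "B \<union> W = verts G" "B \<inter> W = {}" "v \<in> verts G"
  shows "chosen_arc G (\<sigma>B \<inter> \<sigma>W) v \<in> \<sigma>B \<inter> \<sigma>W"
    and "chosen_arc G (\<sigma>B \<inter> \<sigma>W) v \<in> arcs G"
    and "tail G (chosen_arc G (\<sigma>B \<inter> \<sigma>W) v) = v"
proof -
  have "\<exists>!e. e \<in> (\<sigma>B \<inter> \<sigma>W) \<inter> out_arcs G v"
  proof (cases "v \<in> B")
    case True
    then have "v \<in> verts G - W" using assms by blast
    then have "out_arcs G v \<subseteq> \<sigma>W" using assms unfolding pure_stationary_strategy_def by blast
    then have "(\<sigma>B \<inter> \<sigma>W) \<inter> out_arcs G v = \<sigma>B \<inter> out_arcs G v" by blast
    then show ?thesis using True assms(1) unfolding pure_stationary_strategy_def by simp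
  next
    case False
    then have v: "v \<in> verts G - B" "v \<in> W" using assms by blast+
    then have "out_arcs G v \<subseteq> \<sigma>B" using assms unfolding pure_stationary_strategy_def by blast
    then have "(\<sigma>B \<inter> \<sigma>W) \<inter> out_arcs G v = \<sigma>W \<inter> out_arcs G v" by blast
    then show ?thesis using v assms(2) unfolding pure_stationary_strategy_def by simp
  qed
  from theI'[OF this, folded chosen_arc_def]
  show "chosen_arc G (\<sigma>B \<inter> \<sigma>W) v \<in> \<sigma>B \<inter> \<sigma>W"
    and "chosen_arc G (\<sigma>B \<inter> \<sigma>W) v \<in> arcs G"
    and "tail G (chosen_arc G (\<sigma>B \<inter> \<sigma>W) v) = v"
    by (auto simp: out_arcs_def)
qed

lemma reward_sequence_eq_walk:
  assumes "fin_digraph G"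
    and "pure_stationary_strategy G B \<sigma>B" "pure_stationary_strategy G W \<sigma>W"
    and "B \<union> W = verts G" "B \<inter> W = {}" "v0 \<in> verts G"
  shows "reward_sequence G r (\<sigma>B \<inter> \<sigma>W) v0 i = r (walk_arc G (\<sigma>B \<inter> \<sigma>W) v0 i)"
proof -
  interpret fin_digraph G by fact
  define F where "F = \<sigma>B \<inter> \<sigma>W"
  define pos where "pos = walk_position G F v0"
  define p where "p = path_length G F v0"
  define q where "q = cycle_length G F v0"
  have step: "pos (Suc j) = head G (chosen_arc G F (pos j))" for j
    by (simp add: pos_def walk_position_def)
  have verts: "pos j \<in> verts G" for j
  proof (induction j)
    case 0
    then show ?case using assms by (simp add: pos_def walk_position_def)
  next
    case (Suc j)
    then show ?case
      using chosen_arc_props(2)[OF assms(2-5) Suc] by (simp add: step F_def)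
  qed
  have "\<not> inj pos"
    using verts finite_verts finite_imageD[of pos UNIV] finite_subset[of "range pos" "verts G"]
    by blast
  then obtain m n where "pos m = pos n" "m < n"
    by (metis injI linorder_neqE_nat)
  then have "\<exists>q>0. pos (m + q) = pos m"
    by (intro exI[of _ "n - m"]) auto
  then have "\<exists>p. \<exists>q>0. pos (p + q) = pos p" by blast
  then have "\<exists>q>0. pos (p + q) = pos p"
    unfolding p_def path_length_def pos_def by (rule LeastI_ex)
  then have q: "q > 0 \<and> pos (p + q) = pos p"
    unfolding q_def cycle_length_def p_def pos_def by (rule LeastI_ex)
  have per: "pos (p + q + j) = pos (p + j)" for j
    by (induction j) (use q step in auto)
  have per_mult: "pos (p + (j + q * t)) = pos (p + j)" for j t
  proof (induction t)
    case (Suc t)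
    then show ?case using per[of "j + q * t"] by (simp add: algebra_simps)
  qed simp
  have "pos i = pos (p + (i - p) mod q)" if "\<not> i < p"
    using per_mult[of "(i - p) mod q" "(i - p) div q"] that by (simp add: add.commute)
  then show ?thesis
    using q unfolding F_def[symmetric]
    by (auto simp: reward_sequence_def Let_def lasso_def walk_arc_def
        p_def[symmetric] q_def[symmetric] pos_def[symmetric])
qed

end

theory Submission
  imports Defs
begin

text \<open>
  Write \<open>M\<close> for taking partial sums. While the cycle sum of a lasso sequence \<open>a\<close> vanishes, \<open>M a\<close> is
  again a lasso with the same path and cycle lengths, and the discounted mean of \<open>a\<close> is \<open>1 - \<beta>\<close>
  times that of \<open>M a\<close>; a nonzero cycle sum makes every later total reward infinite with its sign.
  So if two plays have different \<open>k\<close>-total rewards, then at some level \<open>m \<le> k\<close> both \<open>M\<^sup>m a\<close> and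
  \<open>M\<^sup>m a'\<close> are lassos whose cycle means differ in the same direction. Their cycle sums are
  combinations of the arc rewards with coefficients in \<open>[0, n\<^sup>m]\<close>, so the cycle means differ by at
  least \<open>\<epsilon>(k, r) / n\<^sup>2\<close>. The discounted mean of a lasso with entries bounded by \<open>n\<^sup>m R\<close> is within
  \<open>2 (1 - \<beta>) n\<^bsup>m+1\<^esup> R\<close> of its cycle mean, since subtracting the cycle mean gives a lasso with
  bounded partial sums. Under the hypothesis on \<open>\<beta>\<close> the two errors cannot bridge the gap, so the
  discounted means are ordered strictly in the same direction as the total rewards.
\<close>

section \<open>Eventually periodic sequences\<close>

text \<open>A lasso is encoded by its shift identity instead of by two lists, so that taking partial
  sums and subtracting constants remain operations on functions with the same \<open>p\<close> and
  \<open>q\<close>. Neither number has to be minimal.\<close>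

definition eventually_periodic :: "nat \<Rightarrow> nat \<Rightarrow> (nat \<Rightarrow> 'a) \<Rightarrow> bool" where
  "eventually_periodic p q b \<longleftrightarrow> q > 0 \<and> (\<forall>i\<ge>p. b (i + q) = b i)"

definition cycle_sum :: "nat \<Rightarrow> nat \<Rightarrow> (nat \<Rightarrow> real) \<Rightarrow> real" where
  "cycle_sum p q b = (\<Sum>i=p..<p+q. b i)"

definition cycle_mean :: "nat \<Rightarrow> nat \<Rightarrow> (nat \<Rightarrow> real) \<Rightarrow> real" where
  "cycle_mean p q b = cycle_sum p q b / real q"

text \<open>Lowering an index by \<open>q\<close> as long as it is at least \<open>p + q\<close>
  does not change the entry, so path and first cycle show all values.\<close>

lemma eventually_periodic_all:
  assumes "eventually_periodic p q b" and "\<And>i. i < p + q \<Longrightarrow> P (b i)"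
  shows "P (b i)"
proof (induction i rule: less_induct)
  case (less i)
  show ?case
  proof (cases "i < p + q")
    case False
    then have "p \<le> i - q" "i - q + q = i" by auto
    then have "b i = b (i - q)"
      using assms(1) unfolding eventually_periodic_def by metis
    moreover have "i - q < i" using False assms(1) unfolding eventually_periodic_def by simp
    ultimately show ?thesis using less by simp
  qed (use assms in auto)
qed

text \<open>Moving the window by one drops \<open>b i\<close> and gains \<open>b (i + q)\<close>,
  which are equal.\<close>

lemma window_sum:
  assumes "eventually_periodic p q b" "p \<le> i"
  shows "(\<Sum>j=i..<i+q. b j) = cycle_sum p q b"
  using assms(2)
proof (induction i rule: dec_induct)
  case base
  then show ?case by (simp add: cycle_sum_def)
next
  case (step i)
  have q: "q > 0" "b (i + q) = b i" using assms(1) step unfolding eventually_periodic_def by auto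
  have "(\<Sum>j=Suc i..<Suc i+q. b j) + b i = (\<Sum>j=i..<Suc (i+q). b j)"
    by (subst sum.atLeast_Suc_lessThan[of i]) auto
  also have "\<dots> = (\<Sum>j=i..<i+q. b j) + b (i + q)"
    by (subst sum.atLeastLessThan_Suc) auto
  finally show ?case using q step by simp
qed

text \<open>Over \<open>q\<close> steps the partial sums grow by the sum of a full window, which
  vanishes by assumption.\<close>

lemma eventually_periodic_partial_sums:
  assumes "eventually_periodic p q b" "cycle_sum p q b = 0"
  shows "eventually_periodic p q (partial_sums b)"
proof -
  have "partial_sums b (i + q) = partial_sums b i" if "p \<le> i" for i
  proof -
    have "{..i+q} = {..i} \<union> {Suc i..<Suc i+q}" by auto
    then have "partial_sums b (i + q) = partial_sums b i + (\<Sum>j=Suc i..<Suc i+q. b j)"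
      unfolding partial_sums_def by (simp only:) (rule sum.union_disjoint; auto)
    then show ?thesis using window_sum[OF assms(1), of "Suc i"] that assms(2) by simp
  qed
  then show ?thesis using assms(1) unfolding eventually_periodic_def by auto
qed

lemma abs_partial_sums_le:
  assumes "\<And>i. i < N \<Longrightarrow> \<bar>b i\<bar> \<le> C" "i < N"
  shows "\<bar>partial_sums b i\<bar> \<le> real N * C"
proof -
  have C: "0 \<le> C" using assms(1)[OF assms(2)] by linarith
  have "\<bar>partial_sums b i\<bar> \<le> (\<Sum>j\<le>i. \<bar>b j\<bar>)"
    unfolding partial_sums_def by (rule sum_abs)
  also have "\<dots> \<le> (\<Sum>j\<le>i. C)" by (rule sum_mono) (use assms in auto)
  also have "\<dots> = real (Suc i) * C" by simp
  also have "\<dots> \<le> real N * C" by (rule mult_right_mono) (use assms C in auto)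
  finally show ?thesis .
qed

lemma eventually_periodic_centered:
  assumes "eventually_periodic p q b"
  shows "eventually_periodic p q (\<lambda>i. b i - cycle_mean p q b)"
    and "cycle_sum p q (\<lambda>i. b i - cycle_mean p q b) = 0"
  using assms by (auto simp: eventually_periodic_def cycle_sum_def cycle_mean_def sum_subtractf)

lemma abs_cycle_mean_le:
  assumes "q > 0" "\<And>i. i < p + q \<Longrightarrow> \<bar>b i\<bar> \<le> C"
  shows "\<bar>cycle_mean p q b\<bar> \<le> C"
proof -
  have "\<bar>cycle_sum p q b\<bar> \<le> (\<Sum>i=p..<p+q. C)"
    unfolding cycle_sum_def by (rule order_trans[OF sum_abs sum_mono]) (use assms in auto)
  then show ?thesis using assms(1) by (simp add: cycle_mean_def field_simps)
qed

text \<open>Centering makes the cycle sum zero, so the partial sums are again periodic and only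
  indices below \<open>p + q\<close> matter. There they have at most \<open>p + q\<close> terms,
  each of size at most \<open>2 * C\<close>.\<close>

lemma abs_partial_sums_centered_le:
  assumes "eventually_periodic p q b" "\<And>i. i < p + q \<Longrightarrow> \<bar>b i\<bar> \<le> C"
  shows "\<bar>partial_sums (\<lambda>i. b i - cycle_mean p q b) i\<bar> \<le> real (p + q) * (2 * C)"
proof (rule eventually_periodic_all[where P = "\<lambda>x. \<bar>x\<bar> \<le> real (p + q) * (2 * C)"])
  show "eventually_periodic p q (partial_sums (\<lambda>i. b i - cycle_mean p q b))"
    by (intro eventually_periodic_partial_sums eventually_periodic_centered assms)
next
  fix i assume i: "i < p + q"
  have q: "q > 0" using assms(1) by (simp add: eventually_periodic_def)
  show "\<bar>partial_sums (\<lambda>i. b i - cycle_mean p q b) i\<bar> \<le> real (p + q) * (2 * C)"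
  proof (rule abs_partial_sums_le[OF _ i])
    fix j assume "j < p + q"
    with assms(2)[OF this] abs_cycle_mean_le[where p = p and b = b, OF q assms(2)]
    show "\<bar>b j - cycle_mean p q b\<bar> \<le> 2 * C" by linarith
  qed
qed

lemma eventually_periodic_bounded:
  fixes b :: "nat \<Rightarrow> real"
  assumes "eventually_periodic p q b"
  obtains C where "\<And>i. \<bar>b i\<bar> \<le> C"
proof -
  have "\<bar>b i\<bar> \<le> (\<Sum>j<p+q. \<bar>b j\<bar>)" if "i < p + q" for i
    by (rule member_le_sum[of i "{..<p+q}" "\<lambda>j. \<bar>b j\<bar>"]) (use that in auto)
  from eventually_periodic_all[OF assms, where P = "\<lambda>x. \<bar>x\<bar> \<le> (\<Sum>j<p+q. \<bar>b j\<bar>)", OF this] that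
  show ?thesis by blast
qed

lemma partial_sums_centered:
  "partial_sums (\<lambda>i. b i - \<mu>) i = partial_sums b i - real (Suc i) * \<mu>"
  by (simp add: partial_sums_def sum_subtractf)

text \<open>Linear growth with slope the cycle mean, up to a bounded error, gives both the limit of
  the averages and the divergence when the mean is nonzero.\<close>

lemma eventually_periodic_partial_sums_approx:
  assumes "eventually_periodic p q b"
  obtains C where "\<And>i. \<bar>partial_sums b i - real (Suc i) * cycle_mean p q b\<bar> \<le> C"
proof -
  obtain C where "\<And>i. \<bar>b i\<bar> \<le> C" using eventually_periodic_bounded[OF assms] by blast
  with abs_partial_sums_centered_le[OF assms, of C]
  show ?thesis using that unfolding partial_sums_centered by blast
qed

section \<open>Total reward\<close>

text \<open>\<open>partial_sums b i\<close> has \<open>i + 1\<close> terms, so it is paired with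
  \<open>T = Suc i\<close>. The shift avoids the average over no terms and does not affect the
  limit.\<close>

lemma limit_mean_eqI:
  assumes "((\<lambda>i. ereal (partial_sums b i / real (Suc i))) \<longlongrightarrow> L) sequentially"
  shows "limit_mean b = L"
proof -
  have "(\<lambda>T. ereal ((\<Sum>j<Suc T. b j) / real (Suc T))) \<longlonglongrightarrow> L"
    using assms unfolding partial_sums_def lessThan_Suc_atMost .
  then have "(\<lambda>T. ereal ((\<Sum>j<T. b j) / real T)) \<longlonglongrightarrow> L"
    by (rule LIMSEQ_imp_Suc)
  then show ?thesis unfolding limit_mean_def by (intro lim_imp_Liminf) auto
qed

lemma limit_mean_eventually_periodic:
  assumes "eventually_periodic p q b"
  shows "limit_mean b = ereal (cycle_mean p q b)"
proof (rule limit_mean_eqI)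
  obtain C where C: "\<And>i. \<bar>partial_sums b i - real (Suc i) * cycle_mean p q b\<bar> \<le> C"
    using eventually_periodic_partial_sums_approx[OF assms] by blast
  have "(\<lambda>i. partial_sums b i / real (Suc i) - cycle_mean p q b) \<longlonglongrightarrow> 0"
  proof (rule Lim_null_comparison)
    show "\<forall>\<^sub>F i in sequentially.
        norm (partial_sums b i / real (Suc i) - cycle_mean p q b) \<le> C / real (Suc i)"
    proof (rule always_eventually, rule allI)
      fix i
      have "partial_sums b i / real (Suc i) - cycle_mean p q b =
          (partial_sums b i - real (Suc i) * cycle_mean p q b) / real (Suc i)"
        by (simp add: diff_divide_distrib del: of_nat_Suc)
      then show "norm (partial_sums b i / real (Suc i) - cycle_mean p q b) \<le> C / real (Suc i)"
        using C[of i] by (simp add: divide_right_mono)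
    qed
    show "(\<lambda>i. C / real (Suc i)) \<longlonglongrightarrow> 0"
      by (rule LIMSEQ_Suc) (rule lim_const_over_n)
  qed
  then have "(\<lambda>i. partial_sums b i / real (Suc i)) \<longlonglongrightarrow> cycle_mean p q b"
    by (simp add: LIM_zero_iff)
  then show "(\<lambda>i. ereal (partial_sums b i / real (Suc i))) \<longlonglongrightarrow> ereal (cycle_mean p q b)"
    by simp
qed

lemma cesaro_at_top:
  assumes "filterlim b at_top sequentially"
  shows "filterlim (\<lambda>i. partial_sums b i / real (Suc i)) at_top sequentially"
proof (rule filterlim_at_top[THEN iffD2], rule allI)
  fix Z :: real
  obtain N where N: "\<And>i. i \<ge> N \<Longrightarrow> Z + 1 \<le> b i"
    using assms unfolding filterlim_at_top eventually_sequentially by blast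
  \<comment> \<open>\<open>D\<close> bounds the total loss caused by the finitely many terms that
    may lie below \<open>Z + 1\<close>. The spare \<open>1\<close> in \<open>Z + 1\<close> later
    absorbs \<open>D / real (Suc i)\<close>.\<close>
  define D where "D = (\<Sum>j<N. \<bar>b j - (Z + 1)\<bar>)"
  have D: "partial_sums b i \<ge> real (Suc i) * (Z + 1) - D" for i
  proof -
    have "- D \<le> - (\<Sum>j\<in>{..i} \<inter> {..<N}. \<bar>b j - (Z + 1)\<bar>)"
      unfolding D_def by (simp add: sum_mono2)
    also have "\<dots> = (\<Sum>j\<le>i. if j \<in> {..<N} then - \<bar>b j - (Z + 1)\<bar> else 0)"
      unfolding sum_negf[symmetric] by (rule sum.inter_restrict) simp
    also have "\<dots> \<le> (\<Sum>j\<le>i. b j - (Z + 1))"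
      by (rule sum_mono) (use N in auto)
    finally show ?thesis by (simp add: partial_sums_def sum_subtractf)
  qed
  have "(\<lambda>i. D / real (Suc i)) \<longlonglongrightarrow> 0"
    by (rule LIMSEQ_Suc) (rule lim_const_over_n)
  then have "\<forall>\<^sub>F i in sequentially. D / real (Suc i) < 1"
    by (rule order_tendstoD) simp
  then show "\<forall>\<^sub>F i in sequentially. Z \<le> partial_sums b i / real (Suc i)"
  proof eventually_elim
    case (elim i)
    then have "D < real (Suc i)" by (simp add: field_simps)
    then have "Z * real (Suc i) \<le> partial_sums b i" using D[of i] by (simp add: algebra_simps)
    then show ?case by (simp add: field_simps)
  qed
qed

lemma partial_sums_at_top:
  assumes "filterlim b at_top sequentially"
  shows "filterlim (partial_sums b) at_top sequentially"
proof -
  have "filterlim (\<lambda>i. real (Suc i)) at_top sequentially"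
    by (rule filterlim_compose[OF filterlim_real_sequentially filterlim_Suc])
  from filterlim_at_top_mult_at_top[OF cesaro_at_top[OF assms] this]
  show ?thesis by simp
qed

lemma partial_sums_uminus: "partial_sums (\<lambda>i. - b i) = (\<lambda>i. - partial_sums b i)"
  by (simp add: partial_sums_def sum_negf)

lemma total_reward_at_top:
  assumes "filterlim b at_top sequentially"
  shows "total_reward k b = \<infinity>"
proof -
  have "filterlim ((partial_sums ^^ k) b) at_top sequentially"
    by (induction k) (use assms partial_sums_at_top in auto)
  from cesaro_at_top[OF this] show ?thesis
    unfolding total_reward_def by (intro limit_mean_eqI) (simp add: tendsto_PInfty_eq_at_top)
qed

lemma total_reward_at_bot:
  assumes "filterlim b at_bot sequentially"
  shows "total_reward k b = - \<infinity>"
proof -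
  \<comment> \<open>Partial sums commute with negation, which reduces the claim to divergence to
    \<open>\<infinity>\<close>.\<close>
  have *: "filterlim (\<lambda>i. - (partial_sums ^^ k) b i) at_top sequentially"
  proof (induction k)
    case 0
    then show ?case using assms by (simp add: filterlim_uminus_at_top)
  next
    case (Suc k)
    then show ?case using partial_sums_at_top[OF Suc] by (simp add: partial_sums_uminus)
  qed
  from cesaro_at_top[OF this]
  have "(\<lambda>i. ereal (- (partial_sums ((partial_sums ^^ k) b) i / real (Suc i)))) \<longlonglongrightarrow> \<infinity>"
    unfolding partial_sums_uminus by (simp add: tendsto_PInfty_eq_at_top)
  then have "(\<lambda>i. - ereal (partial_sums ((partial_sums ^^ k) b) i / real (Suc i))) \<longlonglongrightarrow> - (- \<infinity>)"
    by simp
  then show ?thesis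
    unfolding total_reward_def by (rule limit_mean_eqI[OF ereal_Lim_uminus[THEN iffD2]])
qed

lemma total_reward_Suc: "total_reward (Suc k) a = total_reward k (partial_sums a)"
  by (simp add: total_reward_def funpow_Suc_right del: funpow.simps)

text \<open>The positive slope beats the bounded error, so one application of
  \<open>partial_sums\<close> already diverges, and further applications and averaging preserve
  this.\<close>

lemma total_reward_Suc_pos:
  assumes "eventually_periodic p q b" "cycle_mean p q b > 0"
  shows "total_reward (Suc k) b = \<infinity>"
proof -
  obtain C where C: "\<And>i. \<bar>partial_sums b i - real (Suc i) * cycle_mean p q b\<bar> \<le> C"
    using eventually_periodic_partial_sums_approx[OF assms(1)] by blast
  have "filterlim (\<lambda>i. - C + cycle_mean p q b * real (Suc i)) at_top sequentially"
    by (intro filterlim_tendsto_add_at_top[OF tendsto_const] assms(2)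
        filterlim_tendsto_pos_mult_at_top[OF tendsto_const]
        filterlim_compose[OF filterlim_real_sequentially filterlim_Suc])
  then have "filterlim (partial_sums b) at_top sequentially"
  proof (rule filterlim_at_top_mono)
    have "- C + cycle_mean p q b * real (Suc i) \<le> partial_sums b i" for i
      using C[of i] by (simp add: abs_le_iff mult.commute)
    then show "\<forall>\<^sub>F i in sequentially. - C + cycle_mean p q b * real (Suc i) \<le> partial_sums b i" by simp
  qed
  then show ?thesis by (simp add: total_reward_Suc total_reward_at_top)
qed

lemma total_reward_Suc_neg:
  assumes "eventually_periodic p q b" "cycle_mean p q b < 0"
  shows "total_reward (Suc k) b = - \<infinity>"
proof -
  obtain C where C: "\<And>i. \<bar>partial_sums b i - real (Suc i) * cycle_mean p q b\<bar> \<le> C"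
    using eventually_periodic_partial_sums_approx[OF assms(1)] by blast
  have "filterlim (\<lambda>i. C + cycle_mean p q b * real (Suc i)) at_bot sequentially"
    unfolding filterlim_tendsto_add_at_bot_iff[OF tendsto_const]
    by (intro filterlim_tendsto_neg_mult_at_bot[OF tendsto_const] assms(2)
        filterlim_compose[OF filterlim_real_sequentially filterlim_Suc])
  then have "filterlim (partial_sums b) at_bot sequentially"
  proof (rule filterlim_at_bot_mono)
    have "partial_sums b i \<le> C + cycle_mean p q b * real (Suc i)" for i
      using C[of i] by (simp add: abs_le_iff mult.commute)
    then show "\<forall>\<^sub>F i in sequentially. partial_sums b i \<le> C + cycle_mean p q b * real (Suc i)" by simp
  qed
  then show ?thesis by (simp add: total_reward_Suc total_reward_at_bot)
qed

section \<open>Discounted mean\<close>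

lemma summable_discounted:
  fixes b :: "nat \<Rightarrow> real"
  assumes "0 < \<beta>" "\<beta> < 1" "\<And>i. \<bar>b i\<bar> \<le> C"
  shows "summable (\<lambda>j. norm (\<beta> ^ j * b j))"
proof (rule summable_comparison_test')
  show "summable (\<lambda>j. \<beta> ^ j * C)" using assms by (intro summable_mult2) simp
  show "norm (norm (\<beta> ^ j * b j)) \<le> \<beta> ^ j * C" if "0 \<le> j" for j
    using assms by (simp add: abs_mult)
qed

text \<open>In terms of generating functions at \<beta>, taking partial sums is multiplication by
  the geometric series \<open>1 / (1 - \<beta>)\<close>, by the Cauchy product.\<close>

lemma discounted_mean_partial_sums:
  assumes "0 < \<beta>" "\<beta> < 1" "\<And>i. \<bar>b i\<bar> \<le> C"
  shows "discounted_mean \<beta> b = (1 - \<beta>) * discounted_mean \<beta> (partial_sums b)"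
proof -
  have "(\<Sum>i. \<beta> ^ i * b i) * (\<Sum>i. \<beta> ^ i) = (\<Sum>i. \<Sum>j\<le>i. (\<beta> ^ j * b j) * \<beta> ^ (i - j))"
    by (rule Cauchy_product) (use assms summable_discounted[OF assms] in auto)
  also have "(\<lambda>i. \<Sum>j\<le>i. (\<beta> ^ j * b j) * \<beta> ^ (i - j)) = (\<lambda>i. \<beta> ^ i * partial_sums b i)"
  proof
    fix i
    have "(\<beta> ^ j * b j) * \<beta> ^ (i - j) = \<beta> ^ i * b j" if "j \<le> i" for j
      using that by (metis le_add_diff_inverse mult.assoc mult.commute power_add)
    then show "(\<Sum>j\<le>i. (\<beta> ^ j * b j) * \<beta> ^ (i - j)) = \<beta> ^ i * partial_sums b i"
      unfolding partial_sums_def sum_distrib_left by (intro sum.cong) auto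
  qed
  finally have "(\<Sum>i. \<beta> ^ i * b i) / (1 - \<beta>) = (\<Sum>i. \<beta> ^ i * partial_sums b i)"
    using assms by (simp add: suminf_geometric)
  moreover have "1 - \<beta> \<noteq> 0" using assms(2) by simp
  ultimately have "(\<Sum>i. \<beta> ^ i * b i) = (1 - \<beta>) * (\<Sum>i. \<beta> ^ i * partial_sums b i)"
    by (subst (asm) nonzero_divide_eq_eq) (simp_all add: mult.commute)
  then show ?thesis unfolding discounted_mean_def by (simp only:)
qed

text \<open>The weights \<open>(1 - \<beta>) * \<beta> ^ j\<close> are nonnegative and sum to
  1.\<close>

lemma abs_discounted_mean_le:
  assumes "0 < \<beta>" "\<beta> < 1" "\<And>i. \<bar>b i\<bar> \<le> C"
  shows "\<bar>discounted_mean \<beta> b\<bar> \<le> C"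
proof -
  have "\<bar>\<Sum>j. \<beta> ^ j * b j\<bar> \<le> (\<Sum>j. \<bar>\<beta> ^ j * b j\<bar>)"
    using summable_norm[OF summable_discounted[OF assms]] by simp
  also have "\<dots> \<le> (\<Sum>j. \<beta> ^ j * C)"
  proof (rule suminf_le)
    show "\<bar>\<beta> ^ j * b j\<bar> \<le> \<beta> ^ j * C" for j using assms by (simp add: abs_mult)
    show "summable (\<lambda>j. \<bar>\<beta> ^ j * b j\<bar>)" using summable_discounted[OF assms] by simp
    show "summable (\<lambda>j. \<beta> ^ j * C)" using assms by (intro summable_mult2) simp
  qed
  also have "\<dots> = C / (1 - \<beta>)"
    using assms by (subst suminf_mult2[symmetric]) (auto simp: suminf_geometric)
  finally show ?thesis
    using assms(2) by (simp add: discounted_mean_def abs_mult pos_le_divide_eq mult.commute)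
qed

lemma discounted_mean_diff_const:
  assumes "0 < \<beta>" "\<beta> < 1" "\<And>i. \<bar>b i\<bar> \<le> C"
  shows "discounted_mean \<beta> (\<lambda>i. b i - \<mu>) = discounted_mean \<beta> b - \<mu>"
proof -
  have "(\<Sum>j. \<beta> ^ j * b j - \<beta> ^ j * \<mu>) = (\<Sum>j. \<beta> ^ j * b j) - (\<Sum>j. \<beta> ^ j * \<mu>)"
    using assms summable_norm_cancel[OF summable_discounted[OF assms]]
    by (intro suminf_diff[symmetric] summable_mult2) auto
  also have "(\<Sum>j. \<beta> ^ j * \<mu>) = \<mu> / (1 - \<beta>)"
    using assms by (subst suminf_mult2[symmetric]) (auto simp: suminf_geometric)
  finally show ?thesis
    using assms by (simp add: discounted_mean_def right_diff_distrib)
qed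

text \<open>The deviation is the discounted mean of the centered sequence. Passing to its partial
  sums, which are bounded, extracts the factor \<open>1 - \<beta>\<close>.\<close>

lemma discounted_mean_approx:
  assumes "0 < \<beta>" "\<beta> < 1" and per: "eventually_periodic p q b"
    and C: "\<And>i. i < p + q \<Longrightarrow> \<bar>b i\<bar> \<le> C"
  shows "\<bar>discounted_mean \<beta> b - cycle_mean p q b\<bar> \<le> (1 - \<beta>) * (real (p + q) * (2 * C))"
proof -
  have b: "\<bar>b i\<bar> \<le> C" for i
    using eventually_periodic_all[OF per, where P = "\<lambda>x. \<bar>x\<bar> \<le> C"] C by blast
  have "\<bar>b i - cycle_mean p q b\<bar> \<le> C + \<bar>cycle_mean p q b\<bar>" for i using b[of i] by linarith
  from discounted_mean_partial_sums[OF assms(1,2) this]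
  have "discounted_mean \<beta> b - cycle_mean p q b =
      (1 - \<beta>) * discounted_mean \<beta> (partial_sums (\<lambda>i. b i - cycle_mean p q b))"
    using discounted_mean_diff_const[OF assms(1,2) b] by simp
  also have "\<bar>\<dots>\<bar> \<le> (1 - \<beta>) * (real (p + q) * (2 * C))"
    using assms(2) abs_discounted_mean_le[OF assms(1,2) abs_partial_sums_centered_le[OF per C]]
    by (simp add: abs_mult mult_left_mono)
  finally show ?thesis .
qed

text \<open>
  The witness \<open>m\<close> is the first level at which one of the two cycle sums does not vanish, capped
  at \<open>k\<close>.
\<close>

lemma total_reward_less_imp_level:
  assumes "0 < \<beta>" "\<beta> < 1"
    and "eventually_periodic p q a" "eventually_periodic p' q' a'"
    and "total_reward k a' < total_reward k a"
  shows "\<exists>m\<le>k. eventually_periodic p q ((partial_sums ^^ m) a) \<and>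
      eventually_periodic p' q' ((partial_sums ^^ m) a') \<and>
      cycle_mean p' q' ((partial_sums ^^ m) a') < cycle_mean p q ((partial_sums ^^ m) a) \<and>
      discounted_mean \<beta> a = (1 - \<beta>) ^ m * discounted_mean \<beta> ((partial_sums ^^ m) a) \<and>
      discounted_mean \<beta> a' = (1 - \<beta>) ^ m * discounted_mean \<beta> ((partial_sums ^^ m) a')"
  using assms(3-5)
proof (induction k arbitrary: a a')
  case 0
  then show ?case by (simp add: total_reward_def limit_mean_eventually_periodic)
next
  case (Suc k)
  show ?case
  \<comment> \<open>With both cycle sums zero, one level is peeled off and the induction hypothesis
    is applied to the partial sums. Otherwise level 0 separates the two sequences.\<close>
  proof (cases "cycle_sum p q a = 0 \<and> cycle_sum p' q' a' = 0")
    case True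
    then have per: "eventually_periodic p q (partial_sums a)"
        "eventually_periodic p' q' (partial_sums a')"
      using Suc.prems eventually_periodic_partial_sums by auto
    obtain C C' where "\<And>i. \<bar>a i\<bar> \<le> C" "\<And>i. \<bar>a' i\<bar> \<le> C'"
      using eventually_periodic_bounded Suc.prems by metis
    then have D: "discounted_mean \<beta> a = (1 - \<beta>) * discounted_mean \<beta> (partial_sums a)"
        "discounted_mean \<beta> a' = (1 - \<beta>) * discounted_mean \<beta> (partial_sums a')"
      using discounted_mean_partial_sums[OF assms(1,2)] by blast+
    obtain m where "m \<le> k" and m: "eventually_periodic p q ((partial_sums ^^ m) (partial_sums a))"
      "eventually_periodic p' q' ((partial_sums ^^ m) (partial_sums a'))"
      "cycle_mean p' q' ((partial_sums ^^ m) (partial_sums a'))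
        < cycle_mean p q ((partial_sums ^^ m) (partial_sums a))"
      "discounted_mean \<beta> (partial_sums a)
        = (1 - \<beta>) ^ m * discounted_mean \<beta> ((partial_sums ^^ m) (partial_sums a))"
      "discounted_mean \<beta> (partial_sums a')
        = (1 - \<beta>) ^ m * discounted_mean \<beta> ((partial_sums ^^ m) (partial_sums a'))"
      using Suc.IH[OF per] Suc.prems(3) by (auto simp: total_reward_Suc)
    then show ?thesis
      by (intro exI[of _ "Suc m"]) (simp add: D funpow_Suc_right del: funpow.simps)
  next
    case False
    have q: "q > 0" "q' > 0" using Suc.prems by (auto simp: eventually_periodic_def)
    have nz: "\<not> (cycle_mean p q a = 0 \<and> cycle_mean p' q' a' = 0)"
      using False q by (simp add: cycle_mean_def)
    \<comment> \<open>A negative mean would make the larger total reward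
      \<open>- \<infinity>\<close>, which exceeds nothing. Dually, \<open>a'\<close> cannot have a
      positive mean.\<close>
    have "cycle_mean p q a \<ge> 0"
    proof (rule ccontr)
      assume "\<not> ?thesis"
      then have "total_reward (Suc k) a = - \<infinity>"
        using total_reward_Suc_neg[OF Suc.prems(1)] by simp
      then show False using Suc.prems(3) by simp
    qed
    moreover have "cycle_mean p' q' a' \<le> 0"
    proof (rule ccontr)
      assume "\<not> ?thesis"
      then have "total_reward (Suc k) a' = \<infinity>"
        using total_reward_Suc_pos[OF Suc.prems(2)] by simp
      then show False using Suc.prems(3) by simp
    qed
    ultimately have "cycle_mean p' q' a' < cycle_mean p q a" using nz by linarith
    then show ?thesis using Suc.prems by (intro exI[of _ 0]) simp
  qed
qed

section \<open>Plays\<close>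

text \<open>Injectivity lets \<open>e\<close> occur at most once among the first \<open>N\<close>
  steps, so the counts start with sum at most 1. Each partial sum is at most the previous total, so
  every level multiplies the total by at most \<open>N\<close>.\<close>

lemma arc_count_le:
  fixes w :: "nat \<Rightarrow> 'e"
  assumes "inj_on w {..<N}" "N \<le> n"
  shows "\<exists>c :: nat \<Rightarrow> nat.
    (\<forall>i. real (c i) = (partial_sums ^^ m) (\<lambda>j. of_bool (w j = e)) i) \<and> sum c {..<N} \<le> n ^ m"
proof (induction m)
  case 0
  have "(\<Sum>i<N. of_bool (w i = e)) = card {i \<in> {..<N}. w i = e}"
    by (simp add: of_bool_def sum.If_cases Int_def)
  also have "\<dots> \<le> 1"
    using assms(1) by (auto simp: card_le_Suc0_iff_eq inj_on_def)
  finally show ?case by (intro exI[of _ "\<lambda>i. of_bool (w i = e)"]) auto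
next
  case (Suc m)
  then obtain c :: "nat \<Rightarrow> nat"
    where c: "\<And>i. real (c i) = (partial_sums ^^ m) (\<lambda>j. of_bool (w j = e)) i"
      "sum c {..<N} \<le> n ^ m" by blast
  have "(\<Sum>i<N. \<Sum>j\<le>i. c j) \<le> (\<Sum>i<N. sum c {..<N})"
    by (intro sum_mono sum_mono2) auto
  also have "\<dots> \<le> n * n ^ m" using assms(2) c(2) by (simp add: mult_le_mono)
  finally show ?case
    by (intro exI[of _ "\<lambda>i. \<Sum>j\<le>i. c j"]) (simp add: c(1) partial_sums_def[of "(partial_sums ^^ m) _"])
qed

lemma partial_sums_lincomb:
  "(partial_sums ^^ m) (\<lambda>j. \<Sum>e\<in>A. f e j * r e) i = (\<Sum>e\<in>A. (partial_sums ^^ m) (f e) i * r e)"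
proof (induction m arbitrary: i)
  case (Suc m)
  have "(\<Sum>j\<le>i. \<Sum>e\<in>A. (partial_sums ^^ m) (f e) j * r e)
      = (\<Sum>e\<in>A. (\<Sum>j\<le>i. (partial_sums ^^ m) (f e) j) * r e)"
    by (subst sum.swap) (simp add: sum_distrib_right)
  then show ?case using Suc by (simp add: partial_sums_def[of "(partial_sums ^^ m) _"])
qed simp

text \<open>Each reward is expanded in the indicators of the arcs. Iterated partial sums are linear
  and act on the indicators alone, giving the counts of \<open>arc_count_le\<close>, which are then
  summed over the cycle.\<close>

lemma cycle_sum_lincomb:
  assumes "finite A" "\<And>i. w i \<in> A" "inj_on w {..<p+q}" "p + q \<le> n"
  obtains c :: "'e \<Rightarrow> nat"
  where "\<And>e. c e \<le> n ^ m"
    and "cycle_sum p q ((partial_sums ^^ m) (\<lambda>i. r (w i))) = (\<Sum>e\<in>A. real (c e) * r e)"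
proof -
  obtain d :: "'e \<Rightarrow> nat \<Rightarrow> nat"
    where d: "\<And>e i. real (d e i) = (partial_sums ^^ m) (\<lambda>j. of_bool (w j = e)) i"
      "\<And>e. sum (d e) {..<p+q} \<le> n ^ m"
    using arc_count_le[OF assms(3,4), of m] by metis
  define c where "c e = sum (d e) {p..<p+q}" for e
  have "c e \<le> n ^ m" for e
    unfolding c_def by (rule order_trans[OF sum_mono2 d(2)]) auto
  moreover have "(\<lambda>i. r (w i)) = (\<lambda>i. \<Sum>e\<in>A. of_bool (w i = e) * r e)"
  proof
    fix i show "r (w i) = (\<Sum>e\<in>A. of_bool (w i = e) * r e)"
      using assms(1,2) by (simp add: of_bool_def if_distrib[of "\<lambda>x. x * _"] sum.delta' cong: if_cong)
  qed
  then have "(partial_sums ^^ m) (\<lambda>i. r (w i)) i = (\<Sum>e\<in>A. real (d e i) * r e)" for i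
    by (simp only: partial_sums_lincomb d(1))
  then have "cycle_sum p q ((partial_sums ^^ m) (\<lambda>i. r (w i)))
      = (\<Sum>i=p..<p+q. \<Sum>e\<in>A. real (d e i) * r e)"
    by (simp add: cycle_sum_def)
  then have "cycle_sum p q ((partial_sums ^^ m) (\<lambda>i. r (w i))) = (\<Sum>e\<in>A. real (c e) * r e)"
    by (subst (asm) sum.swap) (simp add: c_def sum_distrib_right)
  ultimately show ?thesis using that by blast
qed

lemma iterated_partial_sums_bound:
  assumes "\<And>i. \<bar>a i\<bar> \<le> R" "N \<le> n" "i < N"
  shows "\<bar>(partial_sums ^^ m) a i\<bar> \<le> real n ^ m * R"
  using assms(3)
proof (induction m arbitrary: i)
  case (Suc m)
  have "0 \<le> R" using assms(1)[of 0] by linarith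
  have "\<bar>partial_sums ((partial_sums ^^ m) a) i\<bar> \<le> real N * (real n ^ m * R)"
    by (rule abs_partial_sums_le) (use Suc in auto)
  also have "\<dots> \<le> real n * (real n ^ m * R)"
    using assms(2) \<open>0 \<le> R\<close> by (intro mult_right_mono) auto
  finally show ?case by simp
qed (use assms in auto)

section \<open>Separation of distinct cycle means\<close>

text \<open>Only finitely many values compete, so the \<open>LEAST\<close> in
  \<open>reward_gap\<close> is attained.\<close>

lemma reward_gap_le:
  fixes G :: "('v, 'e) pre_digraph" and r :: "'e \<Rightarrow> real"
  assumes "finite (arcs G)" "\<And>e. e \<in> arcs G \<Longrightarrow> \<bar>c e\<bar> \<le> int (card (verts G) ^ (l + 1))"
    and "(\<Sum>e\<in>arcs G. of_int (c e) * r e) \<noteq> 0"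
  shows "reward_gap G l r \<le> \<bar>\<Sum>e\<in>arcs G. of_int (c e) * r e\<bar>"
proof -
  define K where "K = int (card (verts G) ^ (l + 1))"
  define f where "f c = \<bar>\<Sum>e\<in>arcs G. of_int (c e) * r e\<bar>" for c :: "'e \<Rightarrow> int"
  define X where "X = {x. x > 0 \<and> (\<exists>c. (\<forall>e\<in>arcs G. \<bar>c e\<bar> \<le> K) \<and> x = f c)}"
  \<comment> \<open>Coefficient functions are total; restricting them to the arcs leaves finitely
    many without changing the sum.\<close>
  have "X \<subseteq> f ` (arcs G \<rightarrow>\<^sub>E {-K..K})"
  proof
    fix x assume "x \<in> X"
    then obtain c where c: "\<forall>e\<in>arcs G. \<bar>c e\<bar> \<le> K" "x = f c" by (auto simp: X_def)
    have "f c = f (restrict c (arcs G))" unfolding f_def by simp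
    moreover have "restrict c (arcs G) \<in> arcs G \<rightarrow>\<^sub>E {-K..K}" using c by (auto simp: abs_le_iff)
    ultimately show "x \<in> f ` (arcs G \<rightarrow>\<^sub>E {-K..K})" using c by auto
  qed
  then have fin: "finite X"
    by (rule finite_subset) (intro finite_imageI finite_PiE assms finite_atLeastAtMost_int)
  have mem: "f c \<in> X" using assms by (auto simp: X_def f_def K_def)
  have "reward_gap G l r = (LEAST x. x \<in> X)"
    by (simp add: reward_gap_def X_def K_def f_def)
  also have "\<dots> = Min X"
    by (rule Least_equality) (use fin mem Min_in in auto)
  also have "\<dots> \<le> f c" using fin mem by simp
  finally show ?thesis by (simp add: f_def)
qed

lemma cycle_mean_gap:
  fixes w w' :: "nat \<Rightarrow> 'e"
  assumes "finite (arcs G)" "m \<le> k" and n: "n = card (verts G)"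
    and w: "\<And>i. w i \<in> arcs G" "inj_on w {..<p+q}" "p + q \<le> n" "q > 0"
    and w': "\<And>i. w' i \<in> arcs G" "inj_on w' {..<p'+q'}" "p' + q' \<le> n" "q' > 0"
    and less: "cycle_mean p' q' ((partial_sums ^^ m) (\<lambda>i. r (w' i)))
      < cycle_mean p q ((partial_sums ^^ m) (\<lambda>i. r (w i)))"
  shows "reward_gap G k r \<le> real n ^ 2 *
      (cycle_mean p q ((partial_sums ^^ m) (\<lambda>i. r (w i)))
       - cycle_mean p' q' ((partial_sums ^^ m) (\<lambda>i. r (w' i))))"
    (is "_ \<le> _ * (?\<mu> - ?\<mu>')")
proof -
  obtain c where c: "\<And>e. c e \<le> n ^ m"
    "cycle_sum p q ((partial_sums ^^ m) (\<lambda>i. r (w i))) = (\<Sum>e\<in>arcs G. real (c e) * r e)"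
    using cycle_sum_lincomb[OF assms(1) w(1-3)] by blast
  obtain c' where c': "\<And>e. c' e \<le> n ^ m"
    "cycle_sum p' q' ((partial_sums ^^ m) (\<lambda>i. r (w' i))) = (\<Sum>e\<in>arcs G. real (c' e) * r e)"
    using cycle_sum_lincomb[OF assms(1) w'(1-3)] by blast
  \<comment> \<open>Multiplying the difference of the means by \<open>q * q'\<close> clears both
    denominators and leaves these integer coefficients.\<close>
  define d where "d e = int (q' * c e) - int (q * c' e)" for e
  have "n > 0" using w by linarith
  have bd: "\<bar>d e\<bar> \<le> int (card (verts G) ^ (k + 1))" for e
  proof -
    have "q' * c e \<le> n * n ^ m" "q * c' e \<le> n * n ^ m"
      using w(3) w'(3) c(1) c'(1) by (auto intro!: mult_le_mono)
    moreover have "n * n ^ m \<le> n ^ (k + 1)"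
      using power_increasing[of "Suc m" "k + 1" n] assms(2) \<open>n > 0\<close> by simp
    ultimately have "int (q' * c e) \<le> int (n ^ (k + 1))" "int (q * c' e) \<le> int (n ^ (k + 1))"
      by linarith+
    \<comment> \<open>Both products are nonnegative, so their difference obeys the same bound as
      each of them, without a factor 2.\<close>
    then show ?thesis unfolding d_def n[symmetric] by linarith
  qed
  have "(\<Sum>e\<in>arcs G. of_int (d e) * r e)
      = real q' * (\<Sum>e\<in>arcs G. real (c e) * r e) - real q * (\<Sum>e\<in>arcs G. real (c' e) * r e)"
    by (simp add: d_def sum_distrib_left sum_subtractf left_diff_distrib mult.assoc)
  also have "\<dots> = real (q * q') * (?\<mu> - ?\<mu>')"
    using w(4) w'(4) by (simp add: cycle_mean_def c(2) c'(2) field_simps)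
  finally have S: "(\<Sum>e\<in>arcs G. of_int (d e) * r e) = real (q * q') * (?\<mu> - ?\<mu>')" .
  have pos: "real (q * q') * (?\<mu> - ?\<mu>') > 0"
    using less w(4) w'(4) by (intro mult_pos_pos) auto
  have "reward_gap G k r \<le> real (q * q') * (?\<mu> - ?\<mu>')"
    using reward_gap_le[where c = d and r = r, OF assms(1) bd] pos unfolding S by linarith
  also have "q * q' \<le> n ^ 2" using w(3) w'(3) by (simp add: power2_eq_square mult_le_mono)
  then have "real (q * q') * (?\<mu> - ?\<mu>') \<le> real n ^ 2 * (?\<mu> - ?\<mu>')"
    using less by (intro mult_right_mono) (auto simp flip: of_nat_power of_nat_mult)
  finally show ?thesis .
qed

section \<open>Plays as eventually periodic walks\<close>

lemma orbit_eventually_periodic: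
  assumes "finite V" "v \<in> V" "\<And>v. v \<in> V \<Longrightarrow> f v \<in> V"
  obtains p q where "eventually_periodic p q (\<lambda>i. (f ^^ i) v)"
    "inj_on (\<lambda>i. (f ^^ i) v) {..<p+q}" "p + q \<le> card V"
proof -
  define x where "x i = (f ^^ i) v" for i
  have V: "x i \<in> V" for i by (induction i) (use assms x_def in auto)
  have card: "N \<le> card V" if "inj_on x {..<N}" for N
    using card_inj_on_le[OF that _ assms(1)] V by auto
  \<comment> \<open>\<open>N\<close> is the index of the first repetition: the points before it are
    distinct, and \<open>x N\<close> equals some \<open>x p\<close>. The period is
    \<open>N - p\<close>, so path and cycle together have length \<open>N\<close>.\<close>
  define N where "N = (LEAST N. \<not> inj_on x {..<Suc N})"
  have "\<not> inj_on x {..<Suc (card V)}" using card[of "Suc (card V)"] by auto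
  then have N: "\<not> inj_on x {..<Suc N}" unfolding N_def by (rule LeastI)
  have inj: "inj_on x {..<N}"
  proof (cases N)
    case (Suc M)
    then show ?thesis using not_less_Least[of M "\<lambda>N. \<not> inj_on x {..<Suc N}"] by (simp add: N_def)
  qed simp
  have "x N \<in> x ` {..<N}"
    using N inj by (simp add: lessThan_Suc)
  then obtain p where p: "p < N" "x N = x p" by auto
  have "x (i + (N - p)) = x i" if "p \<le> i" for i
    using that
  proof (induction i rule: dec_induct)
    case base
    then show ?case using p by simp
  next
    case (step i)
    then show ?case by (simp add: x_def)
  qed
  then have "eventually_periodic p (N - p) x" using p by (simp add: eventually_periodic_def)
  then show ?thesis using that[of p "N - p"] inj card[OF inj] p unfolding x_def by simp
qed

text \<open>The orbit argument applies to the positions. The tail of a chosen arc is the position it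
  leaves, so distinct positions yield distinct arcs.\<close>

lemma play_structure:
  assumes "fin_digraph G"
    and "pure_stationary_strategy G B \<sigma>B" "pure_stationary_strategy G W \<sigma>W"
    and "B \<union> W = verts G" "B \<inter> W = {}" "v0 \<in> verts G"
  obtains p q w where "eventually_periodic p q w" "inj_on w {..<p+q}" "p + q \<le> card (verts G)"
    "\<And>i. w i \<in> arcs G" "reward_sequence G r (\<sigma>B \<inter> \<sigma>W) v0 = (\<lambda>i. r (w i))"
proof -
  interpret fin_digraph G by fact
  define F where "F = \<sigma>B \<inter> \<sigma>W"
  note ca = chosen_arc_props[OF assms(2-5), folded F_def]
  have hV: "head G (chosen_arc G F v) \<in> verts G" if "v \<in> verts G" for v
    using ca(2)[OF that] by simp
  obtain p q where pq: "eventually_periodic p q (walk_position G F v0)"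
    "inj_on (walk_position G F v0) {..<p+q}" "p + q \<le> card (verts G)"
    unfolding walk_position_def
    using orbit_eventually_periodic[of "verts G" v0 "\<lambda>v. head G (chosen_arc G F v)"]
      finite_verts assms(6) hV by blast
  have V: "walk_position G F v0 i \<in> verts G" for i
    by (induction i) (use assms(6) hV in \<open>auto simp: walk_position_def\<close>)
  have "eventually_periodic p q (walk_arc G F v0)"
    using pq(1) by (simp add: eventually_periodic_def walk_arc_def)
  moreover have "inj_on (walk_arc G F v0) {..<p+q}"
  proof (rule inj_onI)
    fix i j assume *: "i \<in> {..<p+q}" "j \<in> {..<p+q}" "walk_arc G F v0 i = walk_arc G F v0 j"
    then have "walk_position G F v0 i = walk_position G F v0 j"
      using ca(3)[OF V] unfolding walk_arc_def by metis
    then show "i = j" using pq(2) * by (auto dest: inj_onD)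
  qed
  moreover have "walk_arc G F v0 i \<in> arcs G" for i
    using ca(2)[OF V] by (simp add: walk_arc_def)
  moreover have "reward_sequence G r (\<sigma>B \<inter> \<sigma>W) v0 = (\<lambda>i. r (walk_arc G F v0 i))"
    using reward_sequence_eq_walk[OF assms] by (auto simp: F_def)
  ultimately show ?thesis using that pq(3) by blast
qed

section \<open>Comparison of two plays\<close>

lemma total_reward_less_imp_discounted_mean_less:
  fixes w w' :: "nat \<Rightarrow> 'e"
  assumes fin: "finite (arcs G)" and n: "n = card (verts G)"
    and \<beta>: "0 < \<beta>" "\<beta> < 1"
      "1 - \<beta> < reward_gap G k r / (4 * real n ^ (k + 3) * max_abs_reward G r)"
    and w: "eventually_periodic p q w" "inj_on w {..<p+q}" "p + q \<le> n" "\<And>i. w i \<in> arcs G"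
    and w': "eventually_periodic p' q' w'" "inj_on w' {..<p'+q'}" "p' + q' \<le> n"
      "\<And>i. w' i \<in> arcs G"
    and less: "total_reward k (\<lambda>i. r (w' i)) < total_reward k (\<lambda>i. r (w i))"
  shows "discounted_mean \<beta> (\<lambda>i. r (w' i)) < discounted_mean \<beta> (\<lambda>i. r (w i))"
proof -
  define R where "R = max_abs_reward G r"
  define a where "a = (\<lambda>i. r (w i))"
  define a' where "a' = (\<lambda>i. r (w' i))"
  have q: "q > 0" "q' > 0" using w(1) w'(1) by (auto simp: eventually_periodic_def)
  have "n > 0" using q w(3) by linarith
  have R: "\<bar>r e\<bar> \<le> R" if "e \<in> arcs G" for e
    unfolding R_def max_abs_reward_def using that fin by simp
  have "0 \<le> R" using R[OF w(4)[of 0]] by linarith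
  \<comment> \<open>For \<open>R = 0\<close> the bound on \<open>1 - \<beta>\<close> is a division
    by zero, which has value 0, contradicting \<open>\<beta> < 1\<close>.\<close>
  moreover have "R \<noteq> 0" using \<beta> by (auto simp: R_def)
  ultimately have "R > 0" by simp
  have per: "eventually_periodic p q a" "eventually_periodic p' q' a'"
    using w(1) w'(1) by (auto simp: eventually_periodic_def a_def a'_def)
  have aR: "\<bar>a i\<bar> \<le> R" "\<bar>a' i\<bar> \<le> R" for i using R w(4) w'(4) by (auto simp: a_def a'_def)
  obtain m where m: "m \<le> k"
      and pm: "eventually_periodic p q ((partial_sums ^^ m) a)"
        "eventually_periodic p' q' ((partial_sums ^^ m) a')"
      and mean: "cycle_mean p' q' ((partial_sums ^^ m) a') < cycle_mean p q ((partial_sums ^^ m) a)"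
      and D: "discounted_mean \<beta> a = (1 - \<beta>) ^ m * discounted_mean \<beta> ((partial_sums ^^ m) a)"
        "discounted_mean \<beta> a' = (1 - \<beta>) ^ m * discounted_mean \<beta> ((partial_sums ^^ m) a')"
    using total_reward_less_imp_level[OF \<beta>(1,2) per] less unfolding a_def a'_def by blast
  define \<mu> where "\<mu> = cycle_mean p q ((partial_sums ^^ m) a)"
  define \<mu>' where "\<mu>' = cycle_mean p' q' ((partial_sums ^^ m) a')"
  \<comment> \<open>The common error bound of \<open>discounted_mean_approx\<close>: the length
    \<open>p + q\<close> is at most \<open>n\<close> and the entries at level \<open>m\<close> are
    at most \<open>real n ^ m * R\<close>.\<close>
  define E where "E = (1 - \<beta>) * (real n * (2 * (real n ^ m * R)))"
  have E: "(1 - \<beta>) * (real N * (2 * (real n ^ m * R))) \<le> E" if "N \<le> n" for N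
    unfolding E_def using that \<beta> \<open>R > 0\<close> by (intro mult_left_mono mult_right_mono) auto
  have "\<bar>discounted_mean \<beta> ((partial_sums ^^ m) a) - \<mu>\<bar> \<le> E"
    unfolding \<mu>_def
    by (rule order_trans[OF discounted_mean_approx[OF \<beta>(1,2) pm(1)] E[OF w(3)]])
      (rule iterated_partial_sums_bound[OF aR(1) w(3)])
  moreover have "\<bar>discounted_mean \<beta> ((partial_sums ^^ m) a') - \<mu>'\<bar> \<le> E"
    unfolding \<mu>'_def
    by (rule order_trans[OF discounted_mean_approx[OF \<beta>(1,2) pm(2)] E[OF w'(3)]])
      (rule iterated_partial_sums_bound[OF aR(2) w'(3)])
  moreover have "2 * E < \<mu> - \<mu>'"
  proof -
    \<comment> \<open>The exponent \<open>m + 3\<close> collects 2 from the denominators of the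
      means, 1 from the length of the lasso and \<open>m\<close> from the size of the
      entries.\<close>
    have "real n ^ 2 * (2 * E) = (1 - \<beta>) * (4 * real n ^ (m + 3) * R)"
      by (simp add: E_def power_add power2_eq_square power3_eq_cube)
    also have "\<dots> \<le> (1 - \<beta>) * (4 * real n ^ (k + 3) * R)"
      using \<beta> \<open>R > 0\<close> \<open>n > 0\<close> m by (intro mult_left_mono mult_right_mono power_increasing) auto
    also have "\<dots> < reward_gap G k r"
      using \<beta>(3) \<open>R > 0\<close> \<open>n > 0\<close> by (simp add: R_def[symmetric] pos_less_divide_eq)
    also have "\<dots> \<le> real n ^ 2 * (\<mu> - \<mu>')"
      unfolding \<mu>_def \<mu>'_def a_def a'_def
      by (rule cycle_mean_gap[OF fin m n w(4) w(2,3) q(1) w'(4) w'(2,3) q(2)])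
        (use mean in \<open>simp add: a_def a'_def\<close>)
    finally show ?thesis using \<open>n > 0\<close> by simp
  qed
  ultimately have "discounted_mean \<beta> ((partial_sums ^^ m) a')
      < discounted_mean \<beta> ((partial_sums ^^ m) a)" by linarith
  \<comment> \<open>The common factor \<open>(1 - \<beta>) ^ m\<close> is positive, so the strict
    order returns to level 0.\<close>
  then show ?thesis using \<beta> D by (simp add: a_def a'_def)
qed

theorem theorem1:
  fixes G :: "('v, 'e) pre_digraph"
    and B W :: "'v set"
    and r :: "'e \<Rightarrow> real"
    and k :: nat
    and \<beta> :: real
    and \<sigma>B \<sigma>W :: "'e set"
  assumes "fin_digraph G"
    and "\<forall>v\<in>verts G. out_arcs G v \<noteq> {}"
    and "B \<union> W = verts G" and "B \<inter> W = {}"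
    and "0 < \<beta>" and "\<beta> < 1"
    and "0 \<le> 1 - \<beta>"
    and "1 - \<beta> < reward_gap G k r / (4 * real (card (verts G)) ^ (k + 3) * max_abs_reward G r)"
    and "uniform_saddle_point (discounted_reward \<beta>) G B W r \<sigma>B \<sigma>W"
  shows "uniform_saddle_point (total_reward k) G B W r \<sigma>B \<sigma>W"
proof -
  interpret fin_digraph G by fact
  \<comment> \<open>Contrapositive of the comparison of two plays: weak inequalities between
    discounted payoffs carry over to total rewards, which gives each saddle point inequality
    separately.\<close>
  have mono: "payoff (total_reward k) G r v0 \<sigma>1 \<tau>1 \<le> payoff (total_reward k) G r v0 \<sigma>2 \<tau>2"
    if le: "payoff (discounted_reward \<beta>) G r v0 \<sigma>1 \<tau>1 \<le> payoff (discounted_reward \<beta>) G r v0 \<sigma>2 \<tau>2"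
      and s: "pure_stationary_strategy G B \<sigma>1" "pure_stationary_strategy G W \<tau>1"
        "pure_stationary_strategy G B \<sigma>2" "pure_stationary_strategy G W \<tau>2"
      and v0: "v0 \<in> verts G" for v0 \<sigma>1 \<tau>1 \<sigma>2 \<tau>2
  proof (rule ccontr)
    assume neg: "\<not> ?thesis"
    obtain p q w where w: "eventually_periodic p q w" "inj_on w {..<p+q}"
      "p + q \<le> card (verts G)" "\<And>i. w i \<in> arcs G"
      "reward_sequence G r (\<sigma>1 \<inter> \<tau>1) v0 = (\<lambda>i. r (w i))"
      using play_structure[OF assms(1) s(1,2) assms(3,4) v0] by blast
    obtain p' q' w' where w': "eventually_periodic p' q' w'" "inj_on w' {..<p'+q'}"
      "p' + q' \<le> card (verts G)" "\<And>i. w' i \<in> arcs G"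
      "reward_sequence G r (\<sigma>2 \<inter> \<tau>2) v0 = (\<lambda>i. r (w' i))"
      using play_structure[OF assms(1) s(3,4) assms(3,4) v0] by blast
    have "discounted_mean \<beta> (\<lambda>i. r (w' i)) < discounted_mean \<beta> (\<lambda>i. r (w i))"
      by (rule total_reward_less_imp_discounted_mean_less[OF finite_arcs refl assms(5,6,8)
            w(1-4) w'(1-4)])
        (use neg in \<open>simp add: payoff_def w(5) w'(5) not_le\<close>)
    then show False using le by (simp add: payoff_def discounted_reward_def w(5) w'(5))
  qed
  show ?thesis
    using assms(9) unfolding uniform_saddle_point_def by (blast intro: mono)
qed

end
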